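(* For every positive integer $n$, the set $\mathscr{C}_{F_{k}}(n)$ of compositions of $n$ in which each part equal to $k$ comes in $F_{k}$ colors is in one-to-one correspondence with the set of words of length $n-1$ over the alphabet $\{0,1,2\}$ in which every maximal run of consecutive $0$s has even length. These sets are enumerated by the Pell numbers $1,2,5,12,29,70,\dots$, i.e. their common cardinality $P_n$ satisfies $P_1=1$, $P_2=2$, $P_n=2P_{n-1}+P_{n-2}$ for $n\ge3$.
   Context: $F_0=0$, $F_1=1$, $F_n=F_{n-1}+F_{n-2}$ for $n\ge2$ are the Fibonacci numbers. A composition of $n$ is an ordered tuple of positive integers (parts) summing to $n$. Given a sequence $(w_k)_{k\ge1}$ of nonnegative integers, a $w$-colored composition of $n$ is a composition $(j_1,\dots,j_m)$ of $n$ together with a choice, for each $i$, of one of $w_{j_i}$ colors for the part $j_i$; $\mathscr{C}_{w_k}(n)$ denotes the set of such colored compositions. Here $w_k=F_k$. *)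

theory Defs
  imports Main "HOL-Number_Theory.Fib"
begin

definition compositions :: "nat \<Rightarrow> nat list set" where
  "compositions n = {js. (\<forall>j \<in> set js. 0 < j) \<and> sum_list js = n}"

text \<open>An entry \<open>(j, c)\<close> is a part \<open>j\<close> carrying the colour \<open>c\<close>; the \<open>w j\<close> colours
  available for \<open>j\<close> are the numbers \<open>1, \<dots>, w j\<close>.  The value \<open>w 0\<close> plays no role,
  since all parts are positive.\<close>

definition colored_compositions :: "(nat \<Rightarrow> nat) \<Rightarrow> nat \<Rightarrow> (nat \<times> nat) list set" where
  "colored_compositions w n =
     {xs. map fst xs \<in> compositions n \<and> (\<forall>(j, c) \<in> set xs. c \<in> {1..w j})}"

definition words_over :: "'a set \<Rightarrow> nat \<Rightarrow> 'a list set" where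
  "words_over A m = {ws. length ws = m \<and> set ws \<subseteq> A}"

text \<open>\<open>maximal_run a r ws\<close>: the word \<open>ws\<close> has a maximal run (nonempty, and not extendable to
  either side) of exactly \<open>r\<close> consecutive letters \<open>a\<close>.\<close>

definition maximal_run :: "'a \<Rightarrow> nat \<Rightarrow> 'a list \<Rightarrow> bool" where
  "maximal_run a r ws \<longleftrightarrow> 0 < r \<and>
     (\<exists>us vs. ws = us @ replicate r a @ vs \<and>
        (us = [] \<or> last us \<noteq> a) \<and> (vs = [] \<or> hd vs \<noteq> a))"

definition even_zero_run_words :: "nat \<Rightarrow> nat list set" where
  "even_zero_run_words m =
     {ws \<in> words_over {0, 1, 2} m. \<forall>r. maximal_run 0 r ws \<longrightarrow> even r}"

end

theory Submission
  imports Defs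
begin

text \<open>Splitting off the first part gives \<open>C (n + 1) = (\<Sum>j\<le>n. F (j + 1) * C (n - j))\<close> for the
  number \<open>C n\<close> of coloured compositions, and the Fibonacci recurrence turns this into the Pell
  recurrence. A word with even zero runs begins with 1, with 2, or with 00, and the rest is again
  such a word, so these words obey the same recurrence.\<close>

section \<open>Colored compositions and their first-part recurrence\<close>

lemma colored_compositions_0: "colored_compositions w 0 = {[]}"
proof -
  have "xs = []" if "xs \<in> colored_compositions w 0" for xs
    using that by (cases xs) (auto simp: colored_compositions_def compositions_def)
  then show ?thesis
    by (auto simp: colored_compositions_def compositions_def)
qed

text \<open>Indexing the first part by its predecessor \<open>j\<close> builds in positivity;
  \<open>j \<le> n\<close> keeps the subtraction \<open>n - j\<close> exact.\<close>

lemma colored_compositions_Suc: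
  "colored_compositions w (Suc n) =
     (\<lambda>(j, c, xs). (Suc j, c) # xs) `
       (SIGMA j:{..n}. {1..w (Suc j)} \<times> colored_compositions w (n - j))"
  (is "?L = ?R")
proof
  show "?L \<subseteq> ?R"
  proof
    fix ys assume ys: "ys \<in> ?L"
    then obtain i c xs where eq: "ys = (i, c) # xs"
      by (cases ys) (auto simp: colored_compositions_def compositions_def)
    with ys obtain j where "i = Suc j"
      by (cases i) (auto simp: colored_compositions_def compositions_def)
    with ys eq have "(j, c, xs) \<in> (SIGMA j:{..n}. {1..w (Suc j)} \<times> colored_compositions w (n - j))"
      by (auto simp: colored_compositions_def compositions_def)
    then show "ys \<in> ?R"
      using eq \<open>i = Suc j\<close> by force
  qed
  show "?R \<subseteq> ?L"
    by (auto simp: colored_compositions_def compositions_def)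
qed

lemma finite_colored_compositions: "finite (colored_compositions w n)"
proof (induction n rule: less_induct)
  case (less n)
  then show ?case
    by (cases n) (auto simp: colored_compositions_0 colored_compositions_Suc)
qed

text \<open>First part, its color and the remainder determine the composition, so the
  parametrization is injective and the sizes of the fibres over \<open>j\<close> add up.\<close>

lemma card_colored_compositions_Suc:
  "card (colored_compositions w (Suc n)) =
     (\<Sum>j\<le>n. w (Suc j) * card (colored_compositions w (n - j)))"
  unfolding colored_compositions_Suc
  by (subst card_image)
     (auto simp: inj_on_def finite_colored_compositions card_cartesian_product)

lemma card_colored_compositions_fib_1: "card (colored_compositions fib (Suc 0)) = 1"
  by (simp add: card_colored_compositions_Suc colored_compositions_0)

lemma card_colored_compositions_fib_2: "card (colored_compositions fib (Suc (Suc 0))) = 2"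
  by (simp add: card_colored_compositions_Suc[of _ "Suc 0"] card_colored_compositions_fib_1
      colored_compositions_0)

text \<open>The empty composition makes \<open>C 0 = 1\<close>, while the convolution of
  \<open>fib\<close> with \<open>C\<close> is 0 at index 0. Hence the recurrence may only refer back
  to positive indices.\<close>

lemma card_colored_compositions_fib_rec:
  "card (colored_compositions fib (Suc (Suc (Suc n)))) =
     2 * card (colored_compositions fib (Suc (Suc n))) + card (colored_compositions fib (Suc n))"
proof -
  define C where "C k = card (colored_compositions fib k)" for k
  have conv: "C (Suc k) = (\<Sum>j\<le>k. fib (Suc j) * C (k - j))" for k
    by (simp add: C_def card_colored_compositions_Suc)
  \<comment> \<open>Since \<open>fib 0 = 0\<close>, a zeroth summand can be added, which turns the
    weights \<open>fib (Suc j)\<close> into \<open>fib j\<close>.\<close>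
  have shifted: "C (Suc n) = (\<Sum>j\<le>Suc n. fib j * C (Suc n - j))"
    by (subst sum.atMost_Suc_shift) (simp add: conv)
  \<comment> \<open>The term split off belongs to a first part 1, which has \<open>fib 1 = 1\<close>
    color. In the remaining sum the weights \<open>fib (Suc (Suc j))\<close> are ready for the
    Fibonacci recurrence.\<close>
  have "C (Suc (Suc (Suc n))) =
      C (Suc (Suc n)) + (\<Sum>j\<le>Suc n. fib (Suc (Suc j)) * C (Suc n - j))"
    by (subst conv, subst sum.atMost_Suc_shift) simp
  also have "(\<Sum>j\<le>Suc n. fib (Suc (Suc j)) * C (Suc n - j)) =
      (\<Sum>j\<le>Suc n. fib (Suc j) * C (Suc n - j)) + (\<Sum>j\<le>Suc n. fib j * C (Suc n - j))"
    unfolding sum.distrib[symmetric] by (rule sum.cong) (auto simp: algebra_simps)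
  also have "\<dots> = C (Suc (Suc n)) + C (Suc n)"
    by (simp only: shifted[symmetric] conv[symmetric])
  finally show ?thesis
    by (simp add: C_def)
qed

section \<open>Runs of even length under prefixing of letters\<close>

definition even_runs :: "'a \<Rightarrow> 'a list \<Rightarrow> bool" where
  "even_runs a ws \<longleftrightarrow> (\<forall>r. maximal_run a r ws \<longrightarrow> even r)"

lemma maximal_runI:
  assumes "0 < r" "ws = us @ replicate r a @ vs"
    "us = [] \<or> last us \<noteq> a" "vs = [] \<or> hd vs \<noteq> a"
  shows "maximal_run a r ws"
  using assms unfolding maximal_run_def by blast

lemma maximal_runE:
  assumes "maximal_run a r ws"
  obtains us vs where "0 < r" "ws = us @ replicate r a @ vs"
    "us = [] \<or> last us \<noteq> a" "vs = [] \<or> hd vs \<noteq> a"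
  using assms unfolding maximal_run_def by blast

lemma even_runs_Nil: "even_runs a []"
  by (auto simp: even_runs_def maximal_run_def)

lemma maximal_run_Cons_neq:
  assumes "x \<noteq> a"
  shows "maximal_run a r (x # ws) \<longleftrightarrow> maximal_run a r ws"
proof
  assume "maximal_run a r (x # ws)"
  then obtain us vs where *: "0 < r" "x # ws = us @ replicate r a @ vs"
    "us = [] \<or> last us \<noteq> a" "vs = [] \<or> hd vs \<noteq> a"
    by (rule maximal_runE)
  \<comment> \<open>An empty \<open>us\<close> would put the nonempty run at the front, forcing
    \<open>x = a\<close>.\<close>
  with assms obtain us' where "us = x # us'"
    by (cases us; cases r) auto
  with * show "maximal_run a r ws"
    by (intro maximal_runI[of _ _ us' _ vs]) (auto split: if_splits)
next
  assume "maximal_run a r ws"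
  then obtain us vs where "0 < r" "ws = us @ replicate r a @ vs"
    "us = [] \<or> last us \<noteq> a" "vs = [] \<or> hd vs \<noteq> a"
    by (rule maximal_runE)
  with assms show "maximal_run a r (x # ws)"
    by (intro maximal_runI[of _ _ "x # us" _ vs]) auto
qed

lemma even_runs_Cons_neq: "x \<noteq> a \<Longrightarrow> even_runs a (x # ws) \<longleftrightarrow> even_runs a ws"
  by (simp add: even_runs_def maximal_run_Cons_neq)

lemma not_even_runs_single:
  assumes "ws = [] \<or> hd ws \<noteq> a"
  shows "\<not> even_runs a (a # ws)"
proof -
  have "maximal_run a 1 (a # ws)"
    using assms by (intro maximal_runI[of _ _ "[]" _ ws]) auto
  then show ?thesis
    unfolding even_runs_def by (meson odd_one)
qed

text \<open>Two extra leading letters \<open>a\<close> either lengthen an initial run by two or form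
  a new run of length two; runs further right are untouched. No parity changes.\<close>

lemma even_runs_double: "even_runs a (a # a # ws) \<longleftrightarrow> even_runs a ws"
proof
  assume even: "even_runs a (a # a # ws)"
  show "even_runs a ws"
    unfolding even_runs_def
  proof (intro allI impI)
    fix r assume "maximal_run a r ws"
    then obtain us vs where *: "0 < r" "ws = us @ replicate r a @ vs"
      "us = [] \<or> last us \<noteq> a" "vs = [] \<or> hd vs \<noteq> a"
      by (rule maximal_runE)
    show "even r"
    proof (cases "us = []")
      case True
      with * have "maximal_run a (Suc (Suc r)) (a # a # ws)"
        by (intro maximal_runI[of _ _ "[]" _ vs]) auto
      with even show ?thesis
        unfolding even_runs_def by fastforce
    next
      case False
      \<comment> \<open>As \<open>us\<close> is nonempty, its last letter still separates this run
        from the new prefix.\<close>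
      with * have "maximal_run a r (a # a # ws)"
        by (intro maximal_runI[of _ _ "a # a # us" _ vs]) auto
      with even show ?thesis
        unfolding even_runs_def by blast
    qed
  qed
next
  assume even: "even_runs a ws"
  show "even_runs a (a # a # ws)"
    unfolding even_runs_def
  proof (intro allI impI)
    fix r assume "maximal_run a r (a # a # ws)"
    then obtain us vs where *: "0 < r" "a # a # ws = us @ replicate r a @ vs"
      "us = [] \<or> last us \<noteq> a" "vs = [] \<or> hd vs \<noteq> a"
      by (rule maximal_runE)
    show "even r"
    proof (cases us)
      case Nil
      \<comment> \<open>A run of length 1 here would be followed by the second \<open>a\<close>,
        against maximality.\<close>
      with * have "r \<noteq> 1"
        by auto
      with * obtain s where s: "r = Suc (Suc s)"
        by (metis One_nat_def not0_implies_Suc less_numeral_extra(3))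
      show ?thesis
      \<comment> \<open>For \<open>s = 0\<close> the run consists of the two new letters only;
        otherwise its tail is an initial run of \<open>ws\<close>.\<close>
      proof (cases "s = 0")
        case False
        with * Nil s have "maximal_run a s ws"
          by (intro maximal_runI[of _ _ "[]" _ vs]) auto
        with even s show ?thesis
          by (simp add: even_runs_def)
      qed (simp add: s)
    next
      case (Cons x us')
      \<comment> \<open>The last letter of \<open>us\<close> is not \<open>a\<close>, so
        \<open>us\<close> must extend beyond the two leading letters.\<close>
      with * obtain us'' where "us = a # a # us''" "us'' \<noteq> []"
        by (cases us') (auto split: if_splits)
      with * have "maximal_run a r ws"
        by (intro maximal_runI[of _ _ us'' _ vs]) auto
      with even show ?thesis
        by (simp add: even_runs_def)
    qed
  qed
qed

section \<open>Counting the words by their first letters\<close>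

lemma even_zero_run_words_iff:
  "ws \<in> even_zero_run_words m \<longleftrightarrow> length ws = m \<and> set ws \<subseteq> {0, 1, 2} \<and> even_runs 0 ws"
  by (auto simp: even_zero_run_words_def words_over_def even_runs_def)

lemma finite_even_zero_run_words: "finite (even_zero_run_words m)"
  by (rule finite_subset[OF _ finite_lists_length_eq[of "{0, 1, 2}" m]])
     (auto simp: even_zero_run_words_iff)

lemma even_zero_run_words_0: "even_zero_run_words 0 = {[]}"
  by (auto simp: even_zero_run_words_iff even_runs_Nil)

lemma even_zero_run_words_1: "even_zero_run_words (Suc 0) = {[1], [2]}"
  by (auto simp: even_zero_run_words_iff length_Suc_conv even_runs_Cons_neq even_runs_Nil
      not_even_runs_single)

lemma even_zero_run_words_Suc_Suc:
  "even_zero_run_words (Suc (Suc m)) =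
     Cons 1 ` even_zero_run_words (Suc m) \<union> Cons 2 ` even_zero_run_words (Suc m) \<union>
     (\<lambda>ws. 0 # 0 # ws) ` even_zero_run_words m"
  (is "?L = ?R")
proof
  show "?L \<subseteq> ?R"
  proof
    fix ws assume ws: "ws \<in> ?L"
    then obtain x y vs where eq: "ws = x # y # vs"
      by (auto simp: even_zero_run_words_iff length_Suc_conv)
    show "ws \<in> ?R"
    proof (cases "x = 0")
      case True
      \<comment> \<open>Otherwise the leading 0 would be a maximal run of length 1.\<close>
      with ws eq have "y = 0"
        using not_even_runs_single[of "y # vs" 0] by (auto simp: even_zero_run_words_iff)
      with True ws eq show ?thesis
        by (auto simp: even_zero_run_words_iff even_runs_double)
    next
      case False
      with ws eq have "x = 1 \<or> x = 2" "y # vs \<in> even_zero_run_words (Suc m)"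
        by (auto simp: even_zero_run_words_iff even_runs_Cons_neq)
      with eq show ?thesis
        by auto
    qed
  qed
  show "?R \<subseteq> ?L"
    by (auto simp: even_zero_run_words_iff even_runs_Cons_neq even_runs_double)
qed

lemma card_even_zero_run_words_Suc_Suc:
  "card (even_zero_run_words (Suc (Suc m))) =
     2 * card (even_zero_run_words (Suc m)) + card (even_zero_run_words m)"
proof -
  have "card (even_zero_run_words (Suc (Suc m))) =
      card (Cons (1::nat) ` even_zero_run_words (Suc m)) +
      card (Cons (2::nat) ` even_zero_run_words (Suc m)) +
      card ((\<lambda>ws. (0::nat) # 0 # ws) ` even_zero_run_words m)"
    unfolding even_zero_run_words_Suc_Suc
    \<comment> \<open>The three images are told apart by the first letter 1, 2 or 0.\<close>
    by (subst card_Un_disjoint; (subst card_Un_disjoint)?)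
       (auto simp: finite_even_zero_run_words)
  then show ?thesis
    by (simp add: card_image inj_on_def)
qed

section \<open>Equality of the two counts and the Pell numbers\<close>

lemma card_colored_compositions_fib_eq:
  "card (colored_compositions fib (Suc m)) = card (even_zero_run_words m)"
proof (induction m rule: less_induct)
  case (less m)
  \<comment> \<open>Both recurrences reach back two steps, so two initial values are compared
    directly.\<close>
  consider "m = 0" | "m = Suc 0" | k where "m = Suc (Suc k)"
    by (metis not0_implies_Suc)
  then show ?case
  proof cases
    case 1
    then show ?thesis
      by (simp add: card_colored_compositions_fib_1 even_zero_run_words_0)
  next
    case 2
    then show ?thesis
      by (simp add: card_colored_compositions_fib_2 even_zero_run_words_1)
  next
    case 3
    with less show ?thesis
      by (simp add: card_colored_compositions_fib_rec card_even_zero_run_words_Suc_Suc)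
  qed
qed

theorem theorem3p2:
  shows "(\<forall>n::nat. 1 \<le> n \<longrightarrow>
            (\<exists>f. bij_betw f (colored_compositions fib n) (even_zero_run_words (n - 1)))) \<and>
         (\<exists>P :: nat \<Rightarrow> nat.
            (\<forall>n. 1 \<le> n \<longrightarrow>
               finite (colored_compositions fib n) \<and> finite (even_zero_run_words (n - 1)) \<and>
               card (colored_compositions fib n) = P n \<and>
               card (even_zero_run_words (n - 1)) = P n) \<and>
            P 1 = 1 \<and> P 2 = 2 \<and> (\<forall>n. 3 \<le> n \<longrightarrow> P n = 2 * P (n - 1) + P (n - 2)))"
\<comment> \<open>The Pell sequence is taken to be the count of colored compositions itself.\<close>
proof (intro conjI exI[of _ "\<lambda>n. card (colored_compositions fib n)"] allI impI)
  fix n :: nat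
  assume "1 \<le> n"
  then show eq: "card (even_zero_run_words (n - 1)) = card (colored_compositions fib n)"
    by (cases n) (simp_all add: card_colored_compositions_fib_eq)
  \<comment> \<open>The bijection is not explicit: it comes from equal cardinality of finite
    sets.\<close>
  show "\<exists>f. bij_betw f (colored_compositions fib n) (even_zero_run_words (n - 1))"
    using eq by (intro finite_same_card_bij finite_colored_compositions
        finite_even_zero_run_words) simp
next
  fix n :: nat
  assume "3 \<le> n"
  then obtain k where "n = Suc (Suc (Suc k))"
    by (metis Suc_le_D numeral_3_eq_3 Suc_le_mono)
  then show "card (colored_compositions fib n) =
      2 * card (colored_compositions fib (n - 1)) + card (colored_compositions fib (n - 2))"
    by (simp add: card_colored_compositions_fib_rec)
qed (simp_all add: finite_colored_compositions finite_even_zero_run_words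
    card_colored_compositions_fib_1 card_colored_compositions_fib_2 numeral_2_eq_2)

end
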